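(* Let $M$ be a finite set of prime numbers. For every $p_i\in M$ and every real number $x\ge 0$, $$f_M(x) = f_{M\setminus\{p_i\}}(x) - f_{M\setminus\{p_i\}}\!\left(\frac{x}{p_i}\right).$$
   Context: For a finite set $S$ of primes and a real number $x\ge 0$, $f_S(x)$ denotes the number of positive integers $\le x$ that are not divisible by any prime in $S$. *)

theory Defs
  imports Complex_Main "HOL-Computational_Algebra.Primes"
begin

definition unsieved_count :: "nat set \<Rightarrow> real \<Rightarrow> nat" where
  "unsieved_count S x = card {n :: nat. 0 < n \<and> real n \<le> x \<and> (\<forall>p\<in>S. \<not> p dvd n)}"

end

theory Submission
  imports Defs
begin

text \<open>The integers removed when sieving by \<open>p\<close> as well are the multiples \<open>p * m\<close>,
  and \<open>p * m\<close> and \<open>m\<close> have the same prime divisors other than \<open>p\<close>.\<close>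

text \<open>Finiteness is what makes \<open>card\<close> additive over the disjoint union below; an
  infinite set would have \<open>card\<close> 0.\<close>

lemma finite_unsieved:
  "finite {n :: nat. 0 < n \<and> real n \<le> x \<and> (\<forall>p\<in>S. \<not> p dvd n)}"
proof (rule finite_subset)
  show "{n :: nat. 0 < n \<and> real n \<le> x \<and> (\<forall>p\<in>S. \<not> p dvd n)} \<subseteq> {..nat \<lfloor>x\<rfloor>}"
    by (auto simp: le_nat_floor)
qed simp

theorem theorem8:
  fixes M :: "nat set" and p :: nat and x :: real
  assumes "finite M" and "\<forall>q\<in>M. prime q" and "p \<in> M" and "0 \<le> x"
  shows "int (unsieved_count M x) =
    int (unsieved_count (M - {p}) x) - int (unsieved_count (M - {p}) (x / real p))"
proof -
  define U where "U S y = {n :: nat. 0 < n \<and> real n \<le> y \<and> (\<forall>q\<in>S. \<not> q dvd n)}" for S y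
  have p: "prime p" "p > 0"
    using assms by (auto simp: prime_gt_0_nat)
  \<comment> \<open>A prime \<open>q\<close> dividing \<open>p * m\<close> divides \<open>p\<close>
    or \<open>m\<close>; the former would force \<open>q = p\<close>, which \<open>M - {p}\<close>
    excludes.\<close>
  have dvd_iff: "q dvd p * m \<longleftrightarrow> q dvd m" if "q \<in> M - {p}" for q m
    using that assms(2) p(1) by (auto simp: prime_dvd_mult_iff primes_dvd_imp_eq)
  have le_iff: "real (p * m) \<le> x \<longleftrightarrow> real m \<le> x / real p" for m
    using p(2) by (simp add: field_simps)
  have mem_iff: "p * m \<in> U (M - {p}) x \<longleftrightarrow> m \<in> U (M - {p}) (x / real p)" for m
    unfolding U_def mem_Collect_eq le_iff using dvd_iff p(2) by auto
  have split: "U (M - {p}) x = U M x \<union> (*) p ` U (M - {p}) (x / real p)"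
  proof (intro equalityI subsetI)
    fix n assume n: "n \<in> U (M - {p}) x"
    show "n \<in> U M x \<union> (*) p ` U (M - {p}) (x / real p)"
    proof (cases "p dvd n")
      case True
      \<comment> \<open>Writing \<open>n = p * m\<close>, the cofactor \<open>m\<close> is the
        required preimage, by \<open>mem_iff\<close>.\<close>
      then show ?thesis using n mem_iff by (auto elim!: dvdE)
    next
      case False
      then show ?thesis using n by (auto simp: U_def)
    qed
  next
    have "U M x \<subseteq> U (M - {p}) x"
      by (auto simp: U_def)
    moreover fix n assume "n \<in> U M x \<union> (*) p ` U (M - {p}) (x / real p)"
    ultimately show "n \<in> U (M - {p}) x"
      using mem_iff by blast
  qed
  \<comment> \<open>Since \<open>p \<in> M\<close>, no member of \<open>U M x\<close> is a multiple
    of \<open>p\<close>.\<close>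
  have "U M x \<inter> (*) p ` U (M - {p}) (x / real p) = {}"
    using assms(3) by (auto simp: U_def)
  moreover have "finite (U S y)" for S y
    unfolding U_def by (rule finite_unsieved)
  \<comment> \<open>Multiplication by \<open>p > 0\<close> is injective, so the image has as many
    elements as \<open>U (M - {p}) (x / real p)\<close>.\<close>
  moreover have "inj_on ((*) p) A" for A
    using p(2) by (auto simp: inj_on_def)
  ultimately have "card (U (M - {p}) x) = card (U M x) + card (U (M - {p}) (x / real p))"
    unfolding split by (simp add: card_Un_disjoint card_image)
  \<comment> \<open>The sum of naturals becomes a difference over \<open>int\<close>, where
    subtraction is not truncated.\<close>
  then show ?thesis
    by (simp add: unsieved_count_def U_def)
qed

end
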